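(* Fix $d\ge 2$ and let $s(n,d)=p(n+1,d)-p(n,d)$, where $p(n,d)$ is the complexity function of the hypercubic billiard language in dimension $d$ coded with $d$ letters. There exists $C>0$ such that for all $n\ge 1$, $$s(n,d)\le C n^{3d-4}.$$
   Context: The billiard in the hypercube $[0,1]^d$ is coded with $d$ letters, the two parallel $(d-1)$-dimensional faces orthogonal to the $i$-th coordinate axis receiving the same letter $i$. $\mathcal{L}(n,d)$ denotes the set of words of length $n$ which are codes (sequences of letters of faces hit) of billiard orbit segments, and $p(n,d)=\mathrm{card}\,\mathcal{L}(n,d)$. *)

theory Defs
  imports Complex_Main
begin

text \<open>Billiard in the hypercube [0,1]^d, letters 0..d-1 (letter i for the two faces
orthogonal to the i-th axis). By the standard unfolding, a billiard orbit corresponds to a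
straight line x + t v in R^d, and hitting a face orthogonal to axis i corresponds to the
i-th coordinate crossing an integer. Points are functions nat => real; only the
coordinates i < d are relevant.

A word w of length n is the code of an orbit segment starting at x with direction v if
there are hitting times 0 < t_0 < ... < t_(n-1) such that at time t_k the coordinate w!k
is an integer, and these are the only faces hit on (0, t_(n-1)] (in particular no edge,
i.e. no simultaneous hit of two faces, occurs on the segment).\<close>

definition billiard_code :: "nat \<Rightarrow> (nat \<Rightarrow> real) \<Rightarrow> (nat \<Rightarrow> real) \<Rightarrow> nat list \<Rightarrow> bool" where
  "billiard_code d x v w \<longleftrightarrow>
     (\<exists>ts :: nat \<Rightarrow> real.
        (\<forall>k < length w. w ! k < d \<and> 0 < ts k \<and> x (w ! k) + ts k * v (w ! k) \<in> \<int>) \<and>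
        (\<forall>k. Suc k < length w \<longrightarrow> ts k < ts (Suc k)) \<and>
        (\<forall>t i. 0 < t \<longrightarrow> t \<le> ts (length w - 1) \<longrightarrow> i < d \<longrightarrow> x i + t * v i \<in> \<int> \<longrightarrow>
             (\<exists>k < length w. t = ts k \<and> i = w ! k)))"

definition billiard_lang :: "nat \<Rightarrow> nat \<Rightarrow> nat list set" where
  "billiard_lang n d = {w. length w = n \<and> (\<exists>x v. billiard_code d x v w)}"

definition billiard_complexity :: "nat \<Rightarrow> nat \<Rightarrow> nat" where
  "billiard_complexity n d = card (billiard_lang n d)"

end

theory Submission
  imports Defs "HOL-Library.FuncSet"
begin

text \<open>The difference \<open>s(n,d)\<close> is at most \<open>d\<close> times the number of left special words \<open>w\<close> of length
  \<open>n\<close>.  In suitable coordinates the lines with a given code form a convex set, so interpolating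
  between two lines coding \<open>a # w\<close> and \<open>b # w\<close> yields a line coding \<open>w\<close> that starts on an edge:
  such lines depend on \<open>2d - 3\<close> parameters.  Cut the space of directions into \<open>O(n^(d-1))\<close> boxes of
  side \<open>1/n\<close>.  Within a box every coordinate is known up to \<open>O(1)\<close> during the first \<open>n\<close> hits, so
  the word depends on the signs of only \<open>O(n)\<close> affine functionals, and these have
  \<open>O(n^(2d-3))\<close> sign patterns.\<close>

section \<open>Sign patterns of affine functionals\<close>

text \<open>Induction on the number of functionals. A pattern on \<open>J\<close> extends in two
  ways to \<open>insert q J\<close> only if it occurs on both sides of the hyperplane where
  functional \<open>q\<close> vanishes. By convexity it then occurs on that hyperplane, where one
  variable can be eliminated. With m = \<open>card J\<close> and k = \<open>card I\<close> the bound
  closes by (m+1)^k + (m+1)^(k-1) <= (m+2)^k.\<close>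

lemma card_sign_patterns_le:
  fixes A :: "'j \<Rightarrow> 'i \<Rightarrow> real" and B :: "'j \<Rightarrow> real"
  assumes "finite J" "finite I"
  shows "card (range (\<lambda>p. {j \<in> J. 0 < B j + (\<Sum>i\<in>I. A j i * p i)})) \<le> (card J + 1) ^ card I"
  using assms
proof (induction J arbitrary: I A B rule: finite_induct)
  case empty
  then show ?case by simp
next
  case (insert q J)
  define f where "f j p = B j + (\<Sum>i\<in>I. A j i * p i)" for j p
  define pat where "pat p = {j \<in> J. 0 < f j p}" for p
  define S0 where "S0 = pat ` {p. f q p \<le> 0}"
  define S1 where "S1 = pat ` {p. 0 < f q p}"
  have fin: "finite S" if "S \<subseteq> range pat" for S
    by (rule finite_subset[of _ "Pow J"]) (use that insert.hyps in \<open>auto simp: pat_def\<close>)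
  have un: "S0 \<union> S1 = range pat"
    unfolding S0_def S1_def image_Un[symmetric] by (rule arg_cong[where f = "image pat"]) auto
  have sub: "S0 \<subseteq> range pat" "S1 \<subseteq> range pat" by (auto simp: S0_def S1_def)
  have "range (\<lambda>p. {j \<in> insert q J. 0 < f j p}) \<subseteq> S0 \<union> insert q ` S1"
  proof
    fix X assume "X \<in> range (\<lambda>p. {j \<in> insert q J. 0 < f j p})"
    then obtain p where X: "X = {j \<in> insert q J. 0 < f j p}" by blast
    show "X \<in> S0 \<union> insert q ` S1"
    proof (cases "0 < f q p")
      case True
      then have "X = insert q (pat p)" using X by (auto simp: pat_def)
      with True show ?thesis by (auto simp: S1_def)
    next
      case False
      then have "X = pat p" using X by (auto simp: pat_def)
      with False show ?thesis by (auto simp: S0_def)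
    qed
  qed
  then have "card (range (\<lambda>p. {j \<in> insert q J. 0 < f j p})) \<le> card (S0 \<union> insert q ` S1)"
    by (rule card_mono[rotated]) (use fin sub in auto)
  also have "\<dots> \<le> card S0 + card S1"
    using card_Un_le[of S0 "insert q ` S1"] card_image_le[OF fin[OF sub(2)], of "insert q"] by linarith
  also have "\<dots> = card (range pat) + card (S0 \<inter> S1)"
    using card_Un_Int[OF fin[OF sub(1)] fin[OF sub(2)]] un by simp
  also have "card (range pat) \<le> (card J + 1) ^ card I"
    unfolding pat_def f_def by (rule insert.IH[OF insert.prems])
  finally have main: "card (range (\<lambda>p. {j \<in> insert q J. 0 < f j p}))
      \<le> (card J + 1) ^ card I + card (S0 \<inter> S1)" by simp
  have "(card J + 1) ^ card I + card (S0 \<inter> S1) \<le> (card J + 2) ^ card I"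
  proof (cases "\<exists>i\<in>I. A q i \<noteq> 0")
    case False
    then have "f q p = B q" for p by (simp add: f_def)
    then have "S0 \<inter> S1 = {}" by (cases "0 < B q") (auto simp: S0_def S1_def)
    then show ?thesis by (simp add: power_mono)
  next
    case True
    then obtain i0 where i0: "i0 \<in> I" "A q i0 \<noteq> 0" by blast
    \<comment> \<open>Coefficients left after solving \<open>f q p = 0\<close> for
      \<open>p i0\<close> and substituting.\<close>
    define A' where "A' j i = A j i - A j i0 * A q i / A q i0" for j i
    define B' where "B' j = B j - A j i0 * B q / A q i0" for j
    define I' where "I' = I - {i0}"
    have cI: "card I = Suc (card I')"
      using i0 insert.prems by (metis I'_def card_Suc_Diff1)
    have elim: "f j p = B' j + (\<Sum>i\<in>I'. A' j i * p i)" if "f q p = 0" for j p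
    proof -
      have s: "f j p = B j + A j i0 * p i0 + (\<Sum>i\<in>I'. A j i * p i)" for j
        using i0 insert.prems by (simp add: f_def I'_def sum.remove)
      have "(\<Sum>i\<in>I'. A' j i * p i) = (\<Sum>i\<in>I'. A j i * p i) - A j i0 / A q i0 * (\<Sum>i\<in>I'. A q i * p i)"
        by (simp add: A'_def sum_distrib_left sum_subtractf algebra_simps)
      moreover have "(\<Sum>i\<in>I'. A q i * p i) = - B q - A q i0 * p i0"
        using s[of q] that by simp
      moreover have "A j i0 / A q i0 * (A q i0 * p i0) = A j i0 * p i0"
        using i0(2) by simp
      ultimately show ?thesis
        by (simp add: s[of j] B'_def right_diff_distrib)
    qed
    have "S0 \<inter> S1 \<subseteq> range (\<lambda>p. {j \<in> J. 0 < B' j + (\<Sum>i\<in>I'. A' j i * p i)})"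
    proof
      fix X assume "X \<in> S0 \<inter> S1"
      then obtain p0 p1 where p: "X = pat p0" "f q p0 \<le> 0" "X = pat p1" "0 < f q p1"
        by (auto simp: S0_def S1_def)
      \<comment> \<open>The parameter at which functional \<open>q\<close> vanishes on the segment
        from \<open>p0\<close> to \<open>p1\<close>. It may be 0, but never 1, so \<open>p0\<close>
        keeps positive weight and strict inequalities survive at \<open>z\<close>.\<close>
      define l where "l = - f q p0 / (f q p1 - f q p0)"
      have l: "0 \<le> l" "l < 1" using p by (auto simp: l_def field_simps)
      define z where "z i = (1 - l) * p0 i + l * p1 i" for i
      have fz: "f j z = (1 - l) * f j p0 + l * f j p1" for j
        by (simp add: f_def z_def algebra_simps sum.distrib sum_distrib_left sum_subtractf)
      have f0: "f q z = 0"
        using p by (simp add: fz l_def field_simps)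
      have "pat z = X"
      proof -
        have "0 < f j z \<longleftrightarrow> j \<in> X" if "j \<in> J" for j
        proof (cases "j \<in> X")
          case True
          then have "0 < f j p0" "0 < f j p1" using p unfolding pat_def by auto
          then have "0 < (1 - l) * f j p0" "0 \<le> l * f j p1" using l by auto
          then show ?thesis using True by (simp add: fz)
        next
          case False
          then have "f j p0 \<le> 0" "f j p1 \<le> 0" using p that unfolding pat_def by fastforce+
          then have "(1 - l) * f j p0 \<le> 0" "l * f j p1 \<le> 0"
            using l by (auto simp: mult_le_0_iff)
          then show ?thesis using False by (simp add: fz)
        qed
        moreover have "X \<subseteq> J" using p by (auto simp: pat_def)
        ultimately show ?thesis unfolding pat_def[of z] by blast
      qed
      then show "X \<in> range (\<lambda>p. {j \<in> J. 0 < B' j + (\<Sum>i\<in>I'. A' j i * p i)})"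
        using elim[OF f0] unfolding pat_def by auto
    qed
    then have "card (S0 \<inter> S1) \<le> card (range (\<lambda>p. {j \<in> J. 0 < B' j + (\<Sum>i\<in>I'. A' j i * p i)}))"
      by (rule card_mono[rotated])
         (rule finite_subset[of _ "Pow J"], use insert.hyps in auto)
    also have "\<dots> \<le> (card J + 1) ^ card I'"
      by (rule insert.IH) (simp add: I'_def insert.prems)
    finally have "(card J + 1) ^ card I + card (S0 \<inter> S1) \<le> (card J + 2) * (card J + 1) ^ card I'"
      by (simp add: cI)
    also have "\<dots> \<le> (card J + 2) * (card J + 2) ^ card I'"
      by (intro mult_left_mono power_mono) auto
    finally show ?thesis by (simp add: cI)
  qed
  with main show ?case using insert.hyps by (simp add: f_def)
qed

section \<open>Letter counts and the linear description of hits\<close>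

definition occurrences :: "nat list \<Rightarrow> nat \<Rightarrow> nat \<Rightarrow> nat" where
  "occurrences w k r = card {j. j < r \<and> w ! j = k}"

lemma occurrences_Suc:
  "occurrences w k (Suc r) = occurrences w k r + (if w ! r = k then 1 else 0)"
proof -
  have "{j. j < Suc r \<and> w ! j = k} = (if w ! r = k then insert r else id) {j. j < r \<and> w ! j = k}"
    by (auto simp: less_Suc_eq)
  then show ?thesis by (simp add: occurrences_def)
qed

lemma occurrences_le: "occurrences w k r \<le> r"
  unfolding occurrences_def by (rule order_trans[OF card_mono[of "{..<r}"]]) auto

lemma occurrences_cong:
  assumes "\<And>j. j < r \<Longrightarrow> w ! j = w' ! j"
  shows "occurrences w k r = occurrences w' k r"
  unfolding occurrences_def by (rule arg_cong[where f = card]) (use assms in auto)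

text \<open>The line \<open>x + t v\<close> is stored as \<open>u = 1/v\<close>, \<open>y = -x/v\<close>: the \<open>k\<close>-th coordinate
  reaches the integer \<open>m\<close> at time \<open>y k + m * u k\<close>, which makes every condition on the order of
  the hits linear.  The hits of \<open>w\<close> take place at the times \<open>ts\<close>.\<close>

definition crossing_schedule ::
    "nat \<Rightarrow> (nat \<Rightarrow> real) \<Rightarrow> (nat \<Rightarrow> real) \<Rightarrow> (nat \<Rightarrow> real) \<Rightarrow> nat list \<Rightarrow> bool" where
  "crossing_schedule d u y ts w \<longleftrightarrow>
     (\<forall>k<d. y k \<le> 0 \<and> 0 < y k + u k) \<and>
     (\<forall>r<length w. w ! r < d \<and> 0 < ts r \<and>
        ts r = y (w ! r) + real (occurrences w (w ! r) (Suc r)) * u (w ! r)) \<and>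
     (\<forall>r<length w. \<forall>k<d. y k + real (occurrences w k (Suc r)) * u k \<le> ts r \<and>
        ts r < y k + (real (occurrences w k (Suc r)) + 1) * u k)"

lemma crossing_scheduleD:
  assumes "crossing_schedule d u y ts w"
  shows "k < d \<Longrightarrow> y k \<le> 0" "k < d \<Longrightarrow> 0 < y k + u k" "k < d \<Longrightarrow> 0 < u k"
    and "r < length w \<Longrightarrow> w ! r < d" "r < length w \<Longrightarrow> 0 < ts r"
    and "r < length w \<Longrightarrow> ts r = y (w ! r) + real (occurrences w (w ! r) (Suc r)) * u (w ! r)"
    and "r < length w \<Longrightarrow> k < d \<Longrightarrow> y k + real (occurrences w k (Suc r)) * u k \<le> ts r"
    and "r < length w \<Longrightarrow> k < d \<Longrightarrow> ts r < y k + (real (occurrences w k (Suc r)) + 1) * u k"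
  using assms unfolding crossing_schedule_def by force+

section \<open>From billiard orbits to crossing schedules\<close>

text \<open>A coordinate that starts in [0,1) and increases crosses the integers 1, ...,
  \<open>M\<close> up to time \<open>ts r\<close>, each exactly once; this puts the positions of the
  letter \<open>k\<close> up to \<open>r\<close> in bijection with \<open>{1..M}\<close>.\<close>

lemma floor_eq_occurrences:
  fixes x v :: real
  assumes v: "0 < v" and x: "0 \<le> x" "x < 1" and r: "r < length w"
    and ts: "\<And>j. j < length w \<Longrightarrow> 0 < ts j" "\<And>i j. i < j \<Longrightarrow> j < length w \<Longrightarrow> ts i < ts j"
    and hits: "\<And>s. 0 < s \<Longrightarrow> s \<le> ts r \<Longrightarrow>
      x + s * v \<in> \<int> \<longleftrightarrow> (\<exists>j<length w. s = ts j \<and> w ! j = k)"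
  shows "\<lfloor>x + ts r * v\<rfloor> = int (occurrences w k (Suc r))"
proof -
  define M where "M = \<lfloor>x + ts r * v\<rfloor>"
  have le_iff: "ts j \<le> ts r \<longleftrightarrow> j \<le> r" if "j < length w" for j
    using ts(2)[of j r] ts(2)[of r j] that r by (metis leD leI le_less linorder_cases)
  have M0: "0 \<le> M" using x v ts(1)[OF r] by (auto simp: M_def)
  have "bij_betw (\<lambda>j. \<lfloor>x + ts j * v\<rfloor>) {j. j < Suc r \<and> w ! j = k} {1..M}"
    unfolding bij_betw_def
  proof
    have int: "x + ts j * v \<in> \<int>" if "j < Suc r" "w ! j = k" for j
    proof -
      have "j < length w" "ts j \<le> ts r" "0 < ts j" using that le_iff[of j] ts(1)[of j] r by auto
      then show ?thesis using hits[of "ts j"] that by blast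
    qed
    show "inj_on (\<lambda>j. \<lfloor>x + ts j * v\<rfloor>) {j. j < Suc r \<and> w ! j = k}"
    proof (rule inj_onI, clarify)
      fix i j assume ij: "i < Suc r" "j < Suc r" "k = w ! i" "w ! j = w ! i"
        and eq: "\<lfloor>x + ts i * v\<rfloor> = \<lfloor>x + ts j * v\<rfloor>"
      have "x + ts i * v = x + ts j * v"
        using int[of i] int[of j] ij eq by (metis Ints_cases floor_of_int)
      then have "ts i = ts j" using v by simp
      then show "i = j"
        using ts(2)[of i j] ts(2)[of j i] ij r by (metis less_Suc_eq_le less_irrefl linorder_neqE_nat order.strict_trans1)
    qed
    show "(\<lambda>j. \<lfloor>x + ts j * v\<rfloor>) ` {j. j < Suc r \<and> w ! j = k} = {1..M}"
    proof (intro equalityI subsetI)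
      fix z assume "z \<in> (\<lambda>j. \<lfloor>x + ts j * v\<rfloor>) ` {j. j < Suc r \<and> w ! j = k}"
      then obtain j where j: "j < Suc r" "w ! j = k" "z = \<lfloor>x + ts j * v\<rfloor>" by auto
      have z: "real_of_int z = x + ts j * v"
        using int[OF j(1,2)] j(3) by (metis Ints_cases floor_of_int)
      have "0 < ts j * v" using ts(1)[of j] j r v by simp
      then have "0 < real_of_int z" using z x by linarith
      moreover have "ts j * v \<le> ts r * v" using le_iff[of j] j r v by simp
      then have "z \<le> M" unfolding j(3) M_def by (intro floor_mono) simp
      ultimately show "z \<in> {1..M}" by simp
    next
      fix z assume "z \<in> {1..M}"
      then have z: "1 \<le> z" "z \<le> M" by auto
      \<comment> \<open>The time at which the coordinate reaches \<open>z\<close>.\<close>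
      define s where "s = (z - x) / v"
      have sz: "x + s * v = z" using v by (simp add: s_def)
      have "0 < s" using z x v by (simp add: s_def)
      moreover have "real_of_int z \<le> x + ts r * v" using z by (simp add: M_def le_floor_iff)
      then have "s \<le> ts r" using v by (simp add: s_def field_simps)
      ultimately obtain j where j: "j < length w" "s = ts j" "w ! j = k"
        using hits[of s] sz by auto
      then have "j < Suc r" using \<open>s \<le> ts r\<close> le_iff by simp
      moreover have "z = \<lfloor>x + ts j * v\<rfloor>" using sz j by simp
      ultimately show "z \<in> (\<lambda>j. \<lfloor>x + ts j * v\<rfloor>) ` {j. j < Suc r \<and> w ! j = k}" using j by blast
    qed
  qed
  then have "occurrences w k (Suc r) = card {1..M}"
    unfolding occurrences_def by (rule bij_betw_same_card)
  then show ?thesis using M0 by (simp add: M_def)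
qed

text \<open>Reflection and integer translation preserve the times of integral values and make a
  nonzero speed positive. A coordinate at rest is replaced by one too slow to reach an integer up to
  time \<open>S\<close>. Positive speeds are what allows passing to \<open>u = 1/v\<close>.\<close>

lemma positive_speed_representative:
  fixes P V S :: real
  assumes "0 \<le> S" and V0: "V = 0 \<Longrightarrow> P \<notin> \<int>"
  shows "\<exists>x v. 0 < v \<and> 0 \<le> x \<and> x < 1 \<and> (x = 0 \<longleftrightarrow> P \<in> \<int>) \<and>
    (\<forall>s. 0 < s \<longrightarrow> s \<le> S \<longrightarrow> (x + s * v \<in> \<int> \<longleftrightarrow> P + s * V \<in> \<int>))"
proof (cases "V = 0")
  case True
  define x where "x = frac P"
  \<comment> \<open>At this speed the value 1 is reached only at time \<open>S + 1\<close>.\<close>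
  define v where "v = (1 - x) / (S + 1)"
  have x: "0 < x" "x < 1"
    using V0[OF True] frac_lt_1[of P] frac_ge_0[of P] frac_eq_0_iff[of P] unfolding x_def by linarith+
  have v: "0 < v" using x assms by (simp add: v_def)
  have "x + s * v \<notin> \<int>" if "0 < s" "s \<le> S" for s
  proof -
    have "s * v < (S + 1) * v" using that v by simp
    also have "\<dots> = 1 - x" using assms by (simp add: v_def)
    finally have "x + s * v < 1" by simp
    moreover have "0 < x + s * v" using x v that by (simp add: add_pos_pos)
    ultimately show ?thesis by (auto elim!: Ints_cases)
  qed
  then show ?thesis using x v True V0 by (intro exI[of _ x] exI[of _ v]) auto
next
  case False
  define \<sigma> where "\<sigma> = sgn V"
  have \<sigma>: "\<sigma> = 1 \<or> \<sigma> = -1" using False by (auto simp: \<sigma>_def sgn_real_def)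
  have iff: "\<sigma> * z \<in> \<int> \<longleftrightarrow> z \<in> \<int>" for z :: real using \<sigma> by (auto simp: minus_in_Ints_iff)
  have "frac (\<sigma> * P) + s * \<bar>V\<bar> = \<sigma> * (P + s * V) - of_int \<lfloor>\<sigma> * P\<rfloor>" for s
    using False by (simp add: frac_def \<sigma>_def algebra_simps sgn_real_def)
  then have "frac (\<sigma> * P) + s * \<bar>V\<bar> \<in> \<int> \<longleftrightarrow> \<sigma> * (P + s * V) \<in> \<int>" for s
    by (metis Ints_add Ints_diff Ints_of_int diff_add_cancel)
  then have "frac (\<sigma> * P) + s * \<bar>V\<bar> \<in> \<int> \<longleftrightarrow> P + s * V \<in> \<int>" for s
    unfolding iff .
  then show ?thesis
    using False iff by (intro exI[of _ "frac (\<sigma> * P)"] exI[of _ "\<bar>V\<bar>"]) (auto simp: frac_lt_1)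
qed

text \<open>The clock is restarted at the first hit, where the line lies on a face of letter
  \<open>a\<close> and, since simultaneous hits are excluded, on no other face. The remaining hits
  form the schedule of \<open>w\<close>.\<close>

lemma billiard_code_Cons_schedule:
  assumes "billiard_code d X V (a # w)"
  shows "a < d \<and> (\<exists>u y ts. crossing_schedule d u y ts w \<and> y a = 0 \<and> (\<forall>k<d. k \<noteq> a \<longrightarrow> y k < 0))"
proof -
  obtain ts where
    hit: "\<And>k. k < Suc (length w) \<Longrightarrow> (a # w) ! k < d \<and> 0 < ts k \<and>
        X ((a # w) ! k) + ts k * V ((a # w) ! k) \<in> \<int>"
    and step: "\<And>k. k < length w \<Longrightarrow> ts k < ts (Suc k)"
    and only: "\<And>t i. 0 < t \<Longrightarrow> t \<le> ts (length w) \<Longrightarrow> i < d \<Longrightarrow> X i + t * V i \<in> \<int> \<Longrightarrow>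
        \<exists>k < Suc (length w). t = ts k \<and> i = (a # w) ! k"
  proof -
    obtain ts where "\<forall>k < Suc (length w). (a # w) ! k < d \<and> 0 < ts k \<and>
        X ((a # w) ! k) + ts k * V ((a # w) ! k) \<in> \<int>"
      "\<forall>k < length w. ts k < ts (Suc k)"
      "\<forall>t i. 0 < t \<longrightarrow> t \<le> ts (length w) \<longrightarrow> i < d \<longrightarrow> X i + t * V i \<in> \<int> \<longrightarrow>
        (\<exists>k < Suc (length w). t = ts k \<and> i = (a # w) ! k)"
      using assms unfolding billiard_code_def by auto
    then show thesis by (intro that[of ts]) blast+
  qed
  have less: "ts i < ts j" if "i < j" "j \<le> length w" for i j
    using that
  proof (induction j)
    case (Suc j)
    then show ?case using step[of j] by (cases "i = j") (auto simp: less_Suc_eq)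
  qed simp
  have le: "ts i \<le> ts j" if "i \<le> j" "j \<le> length w" for i j
    using less[of i j] that by (cases "i = j") auto
  define S where "S = ts (length w) - ts 0"
  define P where "P k = X k + ts 0 * V k" for k
  define ts' where "ts' r = ts (Suc r) - ts 0" for r
  have a: "a < d" using hit[of 0] by simp
  have S: "0 \<le> S" using le[of 0 "length w"] by (simp add: S_def)
  \<comment> \<open>A coordinate resting at an integer would count as a hit at time
    \<open>ts 0 / 2\<close>, before the first one.\<close>
  have nonint: "X k \<notin> \<int>" if k: "k < d" "V k = 0" for k
  proof
    assume "X k \<in> \<int>"
    moreover have "0 < ts 0" using hit[of 0] by simp
    moreover have "ts 0 \<le> ts (length w)" by (rule le) auto
    ultimately obtain j where "j < Suc (length w)" "ts 0 / 2 = ts j"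
      using only[of "ts 0 / 2" k] k by auto
    then show False using le[of 0 j] \<open>0 < ts 0\<close> by auto
  qed
  \<comment> \<open>Hitting times strictly increase, so only one face is hit at
    \<open>ts 0\<close>.\<close>
  have Pint: "P k \<in> \<int> \<longleftrightarrow> k = a" if k: "k < d" for k
  proof
    assume "P k \<in> \<int>"
    then obtain j where "j < Suc (length w)" "ts 0 = ts j" "k = (a # w) ! j"
      using only[of "ts 0" k] hit[of 0] le[of 0 "length w"] k by (auto simp: P_def)
    then show "k = a" using less[of 0 j] by (cases j) auto
  qed (use hit[of 0] in \<open>simp add: P_def\<close>)
  have "\<exists>x v. 0 < v \<and> 0 \<le> x \<and> x < 1 \<and> (x = 0 \<longleftrightarrow> k = a) \<and>
    (\<forall>s. 0 < s \<longrightarrow> s \<le> S \<longrightarrow> (x + s * v \<in> \<int> \<longleftrightarrow> P k + s * V k \<in> \<int>))" if "k < d" for k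
    using positive_speed_representative[OF S, of "V k" "P k"] nonint[OF that] Pint[OF that]
    by (auto simp: P_def)
  then obtain x v where xv: "\<And>k. k < d \<Longrightarrow> 0 < v k \<and> 0 \<le> x k \<and> x k < 1 \<and> (x k = 0 \<longleftrightarrow> k = a)"
    and iff: "\<And>k s. k < d \<Longrightarrow> 0 < s \<Longrightarrow> s \<le> S \<Longrightarrow> x k + s * v k \<in> \<int> \<longleftrightarrow> P k + s * V k \<in> \<int>"
    by metis
  have occ: "\<lfloor>x k + ts' r * v k\<rfloor> = int (occurrences w k (Suc r))" if rk: "r < length w" "k < d" for r k
  proof (rule floor_eq_occurrences)
    show "0 < v k" "0 \<le> x k" "x k < 1" "r < length w" using xv rk by auto
    show "0 < ts' j" if "j < length w" for j using less[of 0 "Suc j"] that by (simp add: ts'_def)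
    show "ts' i < ts' j" if "i < j" "j < length w" for i j
      using less[of "Suc i" "Suc j"] that by (simp add: ts'_def)
    fix s assume s: "0 < s" "s \<le> ts' r"
    have "s \<le> S" using s le[of "Suc r" "length w"] rk by (simp add: ts'_def S_def)
    then have "x k + s * v k \<in> \<int> \<longleftrightarrow> X k + (ts 0 + s) * V k \<in> \<int>"
      using iff[of k s] s rk by (simp add: P_def algebra_simps)
    also have "\<dots> \<longleftrightarrow> (\<exists>j<length w. s = ts' j \<and> w ! j = k)"
    proof
      assume "X k + (ts 0 + s) * V k \<in> \<int>"
      then obtain j where j: "j < Suc (length w)" "ts 0 + s = ts j" "k = (a # w) ! j"
        using only[of "ts 0 + s" k] s hit[of 0] \<open>s \<le> S\<close> rk by (auto simp: S_def)
      then obtain i where "j = Suc i" using s by (cases j) auto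
      then show "\<exists>j<length w. s = ts' j \<and> w ! j = k" using j by (auto simp: ts'_def)
    next
      assume "\<exists>j<length w. s = ts' j \<and> w ! j = k"
      then obtain j where "j < length w" "s = ts' j" "w ! j = k" by blast
      then show "X k + (ts 0 + s) * V k \<in> \<int>" using hit[of "Suc j"] by (simp add: ts'_def)
    qed
    finally show "x k + s * v k \<in> \<int> \<longleftrightarrow> (\<exists>j<length w. s = ts' j \<and> w ! j = k)" .
  qed
  have "crossing_schedule d (\<lambda>k. 1 / v k) (\<lambda>k. - x k / v k) ts' w"
    unfolding crossing_schedule_def
  proof (intro conjI allI impI)
    fix k assume "k < d"
    then show "- x k / v k \<le> 0" "0 < - x k / v k + 1 / v k"
      using xv[of k] by (auto simp: field_simps)
  next
    fix r assume r: "r < length w"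
    define k where "k = w ! r"
    show "w ! r < d" using hit[of "Suc r"] r by simp
    then have k: "k < d" by (simp add: k_def)
    show t: "0 < ts' r" using less[of 0 "Suc r"] r by (simp add: ts'_def)
    have "ts' r \<le> S" using le[of "Suc r" "length w"] r by (simp add: ts'_def S_def)
    then have "x k + ts' r * v k \<in> \<int>"
      using iff[OF k t] hit[of "Suc r"] r by (simp add: ts'_def P_def k_def algebra_simps)
    then have "x k + ts' r * v k = real (occurrences w k (Suc r))"
      using occ[OF r k] by (metis Ints_cases floor_of_int of_int_of_nat_eq)
    then show "ts' r = - x (w ! r) / v (w ! r) + real (occurrences w (w ! r) (Suc r)) * (1 / v (w ! r))"
      using xv[OF k] unfolding k_def by (simp add: field_simps)
  next
    fix r k assume r: "r < length w" and k: "k < d"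
    have "real (occurrences w k (Suc r)) \<le> x k + ts' r * v k"
      "x k + ts' r * v k < real (occurrences w k (Suc r)) + 1"
      using occ[OF r k] by linarith+
    then show "- x k / v k + real (occurrences w k (Suc r)) * (1 / v k) \<le> ts' r"
      "ts' r < - x k / v k + (real (occurrences w k (Suc r)) + 1) * (1 / v k)"
      using xv[OF k] by (simp_all add: diff_divide_distrib[symmetric] pos_divide_le_eq pos_less_divide_eq)
  qed
  moreover have "- x a / v a = 0" using xv[OF a] by simp
  moreover have "\<forall>k<d. k \<noteq> a \<longrightarrow> - x k / v k < 0"
    using xv by (auto simp: less_le)
  ultimately show ?thesis using a by blast
qed

section \<open>Left special words and lines that start on an edge\<close>

text \<open>The conditions of a schedule for a fixed word are linear, so they survive convex
  combination. At the first schedule \<open>y a\<close> is strictly the largest of the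
  \<open>y k\<close>, at the second \<open>y b\<close> exceeds it. Moving from the first to the
  second, some \<open>y c\<close> catches up with \<open>y a\<close>; stopping at the first such
  moment keeps all other \<open>y k\<close> at or below them.\<close>

lemma left_special_schedule:
  assumes A: "crossing_schedule d u1 y1 ts1 w" "y1 a = 0" "\<forall>k<d. k \<noteq> a \<longrightarrow> y1 k < 0" "a < d"
    and B: "crossing_schedule d u2 y2 ts2 w" "y2 b = 0" "\<forall>k<d. k \<noteq> b \<longrightarrow> y2 k < 0" "b < d"
    and "a \<noteq> b"
  shows "\<exists>u y ts c. crossing_schedule d u y ts w \<and> c < d \<and> c \<noteq> a \<and> y a = 0 \<and> y c = 0"
proof -
  define \<alpha> where "\<alpha> k = - y1 k" for k
  define \<beta> where "\<beta> k = y2 a - y2 k" for k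
  define K where "K = {k. k < d \<and> k \<noteq> a \<and> \<beta> k < 0}"
  \<comment> \<open>The mixing parameter at which \<open>k\<close> catches up with \<open>a\<close>;
    \<open>K\<close> holds the axes that overtake \<open>a\<close>, and contains
    \<open>b\<close>.\<close>
  define root where "root k = \<alpha> k / (\<alpha> k - \<beta> k)" for k
  have "finite K" "K \<noteq> {}" using B A(4) \<open>a \<noteq> b\<close> by (auto simp: K_def \<beta>_def)
  then obtain c where c: "c \<in> K" and min: "\<And>k. k \<in> K \<Longrightarrow> root c \<le> root k"
    by (metis arg_min_if_finite(1) arg_min_least)
  define l where "l = root c"
  have \<alpha>: "0 < \<alpha> k" if "k < d" "k \<noteq> a" for k using A(3) that by (simp add: \<alpha>_def)
  have l: "0 < l" "l < 1" using c \<alpha>[of c] by (auto simp: l_def root_def K_def field_simps)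
  have gap: "0 \<le> (1 - l) * \<alpha> k + l * \<beta> k" if "k < d" for k
  proof (cases "k \<in> K")
    case True
    then have "0 < \<alpha> k - \<beta> k" using \<alpha>[of k] by (auto simp: K_def)
    moreover have "l \<le> \<alpha> k / (\<alpha> k - \<beta> k)" using min[OF True] by (simp add: l_def root_def)
    ultimately have "l * (\<alpha> k - \<beta> k) \<le> \<alpha> k" by (simp add: pos_le_divide_eq)
    then show ?thesis by (simp add: algebra_simps)
  next
    case False
    then have "0 \<le> \<beta> k" using that by (auto simp: K_def \<beta>_def)
    moreover have "0 \<le> \<alpha> k" using crossing_scheduleD(1)[OF A(1) that] by (simp add: \<alpha>_def)
    ultimately show ?thesis using l by simp
  qed
  have gap_c: "(1 - l) * \<alpha> c + l * \<beta> c = 0"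
  proof -
    have "0 < \<alpha> c - \<beta> c" using \<alpha>[of c] c by (auto simp: K_def)
    then have "l * (\<alpha> c - \<beta> c) = \<alpha> c" by (simp add: l_def root_def)
    then show ?thesis by (simp add: algebra_simps)
  qed
  define mix where "mix f g k = (1 - l) * f k + l * g k" for f g :: "nat \<Rightarrow> real" and k
  have mix_le: "(1 - l) * p1 + l * p2 \<le> (1 - l) * q1 + l * q2" if "p1 \<le> q1" "p2 \<le> q2" for p1 p2 q1 q2 :: real
    using that l by (intro add_mono mult_left_mono) auto
  have mix_less: "(1 - l) * p1 + l * p2 < (1 - l) * q1 + l * q2" if "p1 < q1" "p2 < q2" for p1 p2 q1 q2 :: real
    using that l by (intro add_strict_mono mult_strict_left_mono) auto
  \<comment> \<open>The common value of the mixed \<open>y a\<close> and \<open>y c\<close>.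
    Subtracting it moves time zero to the moment when both coordinates are integral. Since
    \<open>h\<close> is at most 0, positive times stay positive.\<close>
  define h where "h = mix y1 y2 a"
  have h: "h \<le> 0" using l A(2) crossing_scheduleD(1)[OF B(1) A(4)]
    by (simp add: h_def mix_def mult_nonneg_nonpos)
  have hk: "h - mix y1 y2 k = (1 - l) * \<alpha> k + l * \<beta> k" for k
    using A(2) by (simp add: h_def mix_def \<alpha>_def \<beta>_def algebra_simps)
  have "crossing_schedule d (mix u1 u2) (\<lambda>k. mix y1 y2 k - h) (\<lambda>r. mix ts1 ts2 r - h) w"
    unfolding crossing_schedule_def
  proof (intro conjI allI impI)
    fix k assume k: "k < d"
    show "mix y1 y2 k - h \<le> 0" using gap[OF k] hk[of k] by simp
    have "(1 - l) * 0 + l * 0 < (1 - l) * (y1 k + u1 k) + l * (y2 k + u2 k)"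
      using crossing_scheduleD(2)[OF A(1) k] crossing_scheduleD(2)[OF B(1) k] by (rule mix_less)
    then show "0 < mix y1 y2 k - h + mix u1 u2 k" using h by (simp add: mix_def algebra_simps)
  next
    fix r assume r: "r < length w"
    show "w ! r < d" using crossing_scheduleD(4)[OF A(1) r] .
    have "(1 - l) * 0 + l * 0 < (1 - l) * ts1 r + l * ts2 r"
      using crossing_scheduleD(5)[OF A(1) r] crossing_scheduleD(5)[OF B(1) r] by (rule mix_less)
    then show "0 < mix ts1 ts2 r - h" using h by (simp add: mix_def)
    show "mix ts1 ts2 r - h = mix y1 y2 (w ! r) - h +
        real (occurrences w (w ! r) (Suc r)) * mix u1 u2 (w ! r)"
      unfolding mix_def crossing_scheduleD(6)[OF A(1) r] crossing_scheduleD(6)[OF B(1) r]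
      by (simp add: algebra_simps)
  next
    fix r k assume r: "r < length w" and k: "k < d"
    show "mix y1 y2 k - h + real (occurrences w k (Suc r)) * mix u1 u2 k \<le> mix ts1 ts2 r - h"
      using mix_le[OF crossing_scheduleD(7)[OF A(1) r k] crossing_scheduleD(7)[OF B(1) r k]]
      by (simp add: mix_def algebra_simps)
    show "mix ts1 ts2 r - h < mix y1 y2 k - h + (real (occurrences w k (Suc r)) + 1) * mix u1 u2 k"
      using mix_less[OF crossing_scheduleD(8)[OF A(1) r k] crossing_scheduleD(8)[OF B(1) r k]]
      by (simp add: mix_def algebra_simps)
  qed
  moreover have "mix y1 y2 a - h = 0" "mix y1 y2 c - h = 0" using hk[of c] gap_c by (auto simp: h_def)
  moreover have "c < d" "c \<noteq> a" using c by (auto simp: K_def)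
  ultimately show ?thesis by blast
qed

section \<open>Normalisation and boxes of directions\<close>

text \<open>A change of the unit of time, used to bring the smallest \<open>u k\<close> to 1 and so
  to save one parameter.\<close>

lemma crossing_schedule_scale:
  assumes "crossing_schedule d u y ts w" "0 < s"
  shows "crossing_schedule d (\<lambda>k. u k / s) (\<lambda>k. y k / s) (\<lambda>r. ts r / s) w"
proof -
  have lin: "p / s + q * (z / s) = (p + q * z) / s" for p q z
    by (simp add: add_divide_distrib)
  have add: "p / s + q / s = (p + q) / s" for p q
    by (simp add: add_divide_distrib)
  show ?thesis
    using assms unfolding crossing_schedule_def lin add
    by (intro conjI allI impI)
       (auto simp: divide_le_0_iff zero_less_divide_iff intro!: divide_right_mono divide_strict_right_mono)
qed

text \<open>Words of lines that start on an edge orthogonal to the axes \<open>a\<close> and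
  \<open>b\<close>, with \<open>e\<close> a fastest axis, normalised to speed 1. The value
  \<open>c k\<close> confines the speed \<open>1 / u k\<close> to an interval of length 1/n, so
  \<open>c\<close> names a box of directions.\<close>

definition special_words :: "nat \<Rightarrow> nat \<Rightarrow> nat \<Rightarrow> nat \<Rightarrow> nat \<Rightarrow> (nat \<Rightarrow> nat) \<Rightarrow> nat list set" where
  "special_words d n a b e c = {w. length w = n \<and> (\<exists>u y ts. crossing_schedule d u y ts w \<and>
     y a = 0 \<and> y b = 0 \<and> u e = 1 \<and> (\<forall>k<d. 1 \<le> u k \<and> nat \<lfloor>real n / u k\<rfloor> = c k))}"

text \<open>The axis \<open>e\<close> minimises \<open>u\<close>, and time is rescaled by
  \<open>u e\<close>. The quantified \<open>b\<close> is the axis that catches up with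
  \<open>a\<close> and may differ from the second extending letter.\<close>

lemma left_special_mem_special_words:
  assumes "billiard_code d X V (a # w)" "billiard_code d X' V' (b # w)" "a \<noteq> b" and n: "length w = n"
  shows "\<exists>a<d. \<exists>b\<in>{..<d} - {a}. \<exists>e<d. \<exists>c \<in> {..<d} - {e} \<rightarrow>\<^sub>E {..n}.
    w \<in> special_words d n a b e (c(e := n))"
proof -
  obtain u1 y1 ts1 u2 y2 ts2 where ab: "a < d" "b < d"
    and A: "crossing_schedule d u1 y1 ts1 w" "y1 a = 0" "\<forall>k<d. k \<noteq> a \<longrightarrow> y1 k < 0"
    and B: "crossing_schedule d u2 y2 ts2 w" "y2 b = 0" "\<forall>k<d. k \<noteq> b \<longrightarrow> y2 k < 0"
    using billiard_code_Cons_schedule[OF assms(1)] billiard_code_Cons_schedule[OF assms(2)] by blast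
  obtain u y ts b' where s: "crossing_schedule d u y ts w" "a < d" "b' < d" "b' \<noteq> a" "y a = 0" "y b' = 0"
    using left_special_schedule[OF A ab(1) B ab(2) assms(3)] ab(1) by blast
  obtain e where e: "e < d" "\<And>k. k < d \<Longrightarrow> u e \<le> u k"
    using arg_min_if_finite(1)[of "{..<d}" u] arg_min_least[of "{..<d}" _ u] s(2)
    by (metis empty_iff finite_lessThan lessThan_iff)
  have ue: "0 < u e" using crossing_scheduleD(3)[OF s(1) e(1)] .
  \<comment> \<open>The entry at \<open>e\<close> is left out because it is forced to be
    \<open>n\<close>; hence only d - 1 entries are free.\<close>
  define c where "c = restrict (\<lambda>k. nat \<lfloor>real n / (u k / u e)\<rfloor>) ({..<d} - {e})"
  have ge: "1 \<le> u k / u e" if "k < d" for k using e(2)[OF that] ue by simp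
  have "nat \<lfloor>real n / (u k / u e)\<rfloor> \<le> n" if "k < d" for k
  proof -
    have "real n / (u k / u e) \<le> real n / 1" using ge[OF that] by (intro divide_left_mono) auto
    then have "\<lfloor>real n / (u k / u e)\<rfloor> \<le> int n" by linarith
    then show ?thesis by simp
  qed
  then have "c \<in> {..<d} - {e} \<rightarrow>\<^sub>E {..n}" by (auto simp: c_def)
  moreover have "w \<in> special_words d n a b' e (c(e := n))"
    unfolding special_words_def
    using n crossing_schedule_scale[OF s(1) ue] s(5,6) ue ge
    by (intro CollectI conjI exI[of _ "\<lambda>k. u k / u e"] exI[of _ "\<lambda>k. y k / u e"]
        exI[of _ "\<lambda>r. ts r / u e"]) (auto simp: c_def)
  ultimately show ?thesis using s e(1) by blast
qed

section \<open>Determining a word by linearly many comparisons\<close>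

text \<open>Up to time T, axis \<open>k\<close> is crossed about T / \<open>u k\<close> times. The
  speed is known up to 1/n and T stays below n + 1, so replacing T by \<tau> and the speed by c/n
  costs only a bounded error.\<close>

lemma occurrences_near:
  assumes s: "crossing_schedule d u y ts w" and n: "length w = n" and r: "r < n" and k: "k < d"
    and u: "1 \<le> u k" and e: "e < d" "u e = 1" and c: "nat \<lfloor>real n / u k\<rfloor> = c"
  defines "\<tau> \<equiv> nat \<lfloor>ts r\<rfloor>"
  shows "\<tau> \<le> n" "\<tau> * c div n \<le> occurrences w k (Suc r)" "occurrences w k (Suc r) \<le> \<tau> * c div n + 3"
proof -
  define q where "q = occurrences w k (Suc r)"
  have rw: "r < length w" using r n by simp
  have T: "0 < ts r" using crossing_scheduleD(5)[OF s rw] .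
  have \<tau>: "real \<tau> \<le> ts r" "ts r < real \<tau> + 1" using T unfolding \<tau>_def by linarith+
  \<comment> \<open>Axis \<open>e\<close> has speed 1 and therefore acts as a clock.\<close>
  have "ts r < real (occurrences w e (Suc r)) + 1"
    using crossing_scheduleD(8)[OF s rw e(1)] crossing_scheduleD(1)[OF s e(1)] e(2) by simp
  moreover have "real (occurrences w e (Suc r)) \<le> real n"
    using occurrences_le[of w e "Suc r"] r by simp
  ultimately show \<tau>n: "\<tau> \<le> n" using \<tau> by linarith
  have c_le: "real c * u k \<le> real n" and c_gt: "real n < (real c + 1) * u k"
  proof -
    have "0 \<le> real n / u k" using u by simp
    then have "real c \<le> real n / u k" "real n / u k < real c + 1" using c by linarith+
    then show "real c * u k \<le> real n" "real n < (real c + 1) * u k"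
      using u by (simp_all add: field_simps)
  qed
  have "real c * 1 \<le> real c * u k" using u by (intro mult_left_mono) auto
  then have cn: "c \<le> n" using c_le by simp
  have lo: "ts r < (real q + 1) * u k" and hi: "(real q - 1) * u k < ts r"
    using crossing_scheduleD(7,8)[OF s rw k] crossing_scheduleD(1,2)[OF s k]
    by (simp_all add: q_def algebra_simps)
  have div: "\<tau> * c div n * n \<le> \<tau> * c" "\<tau> * c < (\<tau> * c div n + 1) * n"
    using r by (simp_all add: dividend_less_div_times)
  have "real (\<tau> * c) * u k = real \<tau> * (real c * u k)" by simp
  also have "\<dots> \<le> ts r * real n" using \<tau> c_le u by (intro mult_mono) auto
  also have "\<dots> < (real q + 1) * u k * real n" using lo r by simp
  finally have "real (\<tau> * c) * u k < real ((q + 1) * n) * u k" by (simp add: algebra_simps)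
  then have "\<tau> * c < (q + 1) * n" using u by (metis mult_less_cancel_right_pos of_nat_less_iff less_le_trans zero_less_one)
  then have "\<tau> * c div n * n < (q + 1) * n" using div by linarith
  then show "\<tau> * c div n \<le> occurrences w k (Suc r)"
    unfolding mult_less_cancel2 by (simp add: q_def)
  have "(real q - 1) * u k * real n < (real \<tau> + 1) * real n" using hi \<tau> r by simp
  also have "\<dots> < (real \<tau> + 1) * ((real c + 1) * u k)" using c_gt by (intro mult_strict_left_mono) auto
  finally have "((real q - 1) * real n) * u k < ((real \<tau> + 1) * (real c + 1)) * u k" by (simp add: algebra_simps)
  then have "(real q - 1) * real n < (real \<tau> + 1) * (real c + 1)"
    using u by (simp add: mult_less_cancel_right_pos)
  then have "real (q * n) < real (\<tau> * c + \<tau> + c + 1 + n)" by (simp add: algebra_simps)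
  then have "q * n < \<tau> * c + \<tau> + c + 1 + n" by (simp only: of_nat_less_iff)
  \<comment> \<open>The terms \<tau>, \<open>c\<close> and \<open>n\<close> contribute at most
    \<open>3 * n\<close>; the remaining 1 is absorbed by the strict upper bound on
    \<open>\<tau> * c\<close>.\<close>
  also have "\<dots> \<le> (\<tau> * c div n + 1) * n + 3 * n" using div \<tau>n cn by linarith
  also have "\<dots> = (\<tau> * c div n + 4) * n" by (simp add: algebra_simps)
  finally show "occurrences w k (Suc r) \<le> \<tau> * c div n + 3"
    by (simp add: q_def)
qed

text \<open>Pairs of crossings (axis, integer) whose order may matter. Both indices are predicted
  from the same \<tau>, which keeps their number linear in \<open>n\<close>. Offsets reach 4, one
  beyond the window of \<open>occurrences_near\<close>, because the next crossing of the second axis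
  is compared too.\<close>

definition relevant_pairs :: "nat \<Rightarrow> nat \<Rightarrow> (nat \<Rightarrow> nat) \<Rightarrow> ((nat \<times> nat) \<times> (nat \<times> nat)) set" where
  "relevant_pairs d n c = (\<lambda>(k, l, \<tau>, i, j). ((k, \<tau> * c k div n + i), (l, \<tau> * c l div n + j))) `
     ({..<d} \<times> {..<d} \<times> {..n} \<times> {..4} \<times> {..4})"

lemma finite_relevant_pairs: "finite (relevant_pairs d n c)"
  by (simp add: relevant_pairs_def)

lemma card_relevant_pairs_le: "card (relevant_pairs d n c) \<le> 25 * d * d * (n + 1)"
proof -
  have "card (relevant_pairs d n c) \<le> card ({..<d} \<times> {..<d} \<times> {..n} \<times> {..4::nat} \<times> {..4::nat})"
    unfolding relevant_pairs_def by (rule card_image_le) simp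
  then show ?thesis by (simp add: card_cartesian_product algebra_simps)
qed

definition time_gap :: "(nat \<Rightarrow> real) \<Rightarrow> (nat \<Rightarrow> real) \<Rightarrow> (nat \<times> nat) \<times> (nat \<times> nat) \<Rightarrow> real" where
  "time_gap u y = (\<lambda>((k, m), (l, m')). (y l + real m' * u l) - (y k + real m * u k))"

text \<open>At the first position where the words differ all previous letter counts agree. There
  \<open>w\<close> crosses \<open>k\<close> before the next crossing of \<open>l\<close>, while
  \<open>w'\<close> does the opposite, and this pair of crossings is among the relevant
  ones.\<close>

lemma eq_if_same_pattern:
  assumes w: "crossing_schedule d u y ts w" "length w = n"
    and w': "crossing_schedule d u' y' ts' w'" "length w' = n"
    and e: "e < d" "u e = 1"
    and u: "\<And>k. k < d \<Longrightarrow> 1 \<le> u k \<and> nat \<lfloor>real n / u k\<rfloor> = c k"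
    and pat: "\<And>j. j \<in> relevant_pairs d n c \<Longrightarrow> 0 < time_gap u y j \<Longrightarrow> 0 < time_gap u' y' j"
  shows "w = w'"
proof (rule ccontr)
  assume "w \<noteq> w'"
  then have "\<exists>r. r < n \<and> w ! r \<noteq> w' ! r" using w(2) w'(2) by (auto simp: list_eq_iff_nth_eq)
  then obtain r where r: "r < n" "w ! r \<noteq> w' ! r" and least: "\<And>j. j < r \<Longrightarrow> w ! j = w' ! j"
    using exists_least_iff[of "\<lambda>r. r < n \<and> w ! r \<noteq> w' ! r"] by (metis less_trans)
  define k l where "k = w ! r" and "l = w' ! r"
  have rw: "r < length w" "r < length w'" using r w(2) w'(2) by auto
  have kl: "k < d" "l < d"
    using crossing_scheduleD(4)[OF w(1) rw(1)] crossing_scheduleD(4)[OF w'(1) rw(2)] by (auto simp: k_def l_def)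
  define p q where "p = occurrences w k r" and "q = occurrences w l r"
  have occ: "occurrences w k (Suc r) = Suc p" "occurrences w l (Suc r) = q"
    "occurrences w' k (Suc r) = p" "occurrences w' l (Suc r) = Suc q"
    using r(2) occurrences_cong[of r w w', OF least]
    by (auto simp: occurrences_Suc p_def q_def k_def l_def)
  define \<tau> where "\<tau> = nat \<lfloor>ts r\<rfloor>"
  note near = occurrences_near[OF w r(1) _ _ e, folded \<tau>_def]
  have k: "\<tau> \<le> n" "\<tau> * c k div n \<le> Suc p" "Suc p \<le> \<tau> * c k div n + 3"
    using near[OF kl(1)] u[OF kl(1)] occ by auto
  have l: "\<tau> * c l div n \<le> q" "q \<le> \<tau> * c l div n + 3"
    using near[OF kl(2)] u[OF kl(2)] occ by auto
  \<comment> \<open>Here \<open>Suc p\<close> counts crossings after the hit \<open>r\<close> of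
    \<open>w\<close>, whereas \<open>q\<close> does not yet count the next crossing of
    \<open>l\<close>; hence the \<open>Suc q\<close>.\<close>
  have "((k, Suc p), (l, Suc q)) \<in> relevant_pairs d n c"
    unfolding relevant_pairs_def
    by (rule image_eqI[where x = "(k, l, \<tau>, Suc p - \<tau> * c k div n, Suc q - \<tau> * c l div n)"])
       (use k l kl in auto)
  moreover have "0 < time_gap u y ((k, Suc p), (l, Suc q))"
    using crossing_scheduleD(6)[OF w(1) rw(1)] crossing_scheduleD(8)[OF w(1) rw(1) kl(2)] occ
    by (simp add: time_gap_def k_def[symmetric] add.commute)
  ultimately have "0 < time_gap u' y' ((k, Suc p), (l, Suc q))" by (rule pat)
  then show False
    using crossing_scheduleD(6)[OF w'(1) rw(2)] crossing_scheduleD(8)[OF w'(1) rw(2) kl(1)] occ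
    by (simp add: time_gap_def l_def[symmetric] add.commute)
qed

text \<open>The unknowns are the \<open>u k\<close> with \<open>k \<noteq> e\<close> and the \<open>y k\<close> with \<open>k \<noteq> a, b\<close>, together
  \<open>(d - 1) + (d - 2)\<close> many.\<close>

lemma card_special_words_le:
  assumes ab: "a < d" "b < d" "a \<noteq> b" and e: "e < d"
  shows "card (special_words d n a b e c) \<le> (25 * d * d * (n + 1) + 1) ^ (2 * d - 3)"
proof -
  define W where "W = special_words d n a b e c"
  define J where "J = relevant_pairs d n c"
  \<comment> \<open>\<open>Inl h\<close> stands for the unknown \<open>u h\<close>,
    \<open>Inr h\<close> for \<open>y h\<close>. The set \<open>D\<close> holds the three unknowns
    fixed by normalisation, with values \<open>base\<close>; their contribution becomes the constant
    \<open>B\<close>.\<close>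
  define U :: "(nat + nat) set" where "U = Inl ` {..<d} \<union> Inr ` {..<d}"
  define D :: "(nat + nat) set" where "D = {Inl e, Inr a, Inr b}"
  define base :: "nat + nat \<Rightarrow> real" where "base i = (if i = Inl e then 1 else 0)" for i
  \<comment> \<open>Written as a difference of two terms, so that the case \<open>k = l\<close> is
    covered as well.\<close>
  define A :: "(nat \<times> nat) \<times> (nat \<times> nat) \<Rightarrow> nat + nat \<Rightarrow> real" where
    "A = (\<lambda>((k, m), (l, m')) i. case i of
       Inl h \<Rightarrow> (if h = l then real m' else 0) - (if h = k then real m else 0)
     | Inr h \<Rightarrow> (if h = l then 1 else 0) - (if h = k then 1 else 0))"
  define B where "B j = (\<Sum>i\<in>D. A j i * base i)" for j
  have DU: "D \<subseteq> U" using ab e by (auto simp: D_def U_def)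
  have fin: "finite U" by (simp add: U_def)
  have "card U = 2 * d"
    unfolding U_def by (subst card_Un_disjoint) (auto simp: card_image)
  moreover have "card D = 3" using ab by (simp add: D_def)
  ultimately have card_UD: "card (U - D) = 2 * d - 3"
    using card_Diff_subset[OF finite_subset[OF DU fin] DU] by simp
  have gap: "time_gap u y j = B j + (\<Sum>i\<in>U - D. A j i * case_sum u y i)"
    if fixed: "y a = 0" "y b = 0" "u e = 1" "j \<in> J" for u y j
  proof -
    obtain k m l m' where j: "j = ((k, m), (l, m'))" "k < d" "l < d"
      using fixed(4) by (auto simp: J_def relevant_pairs_def)
    have "(\<Sum>i\<in>U. A j i * case_sum u y i) =
        (\<Sum>h<d. A j (Inl h) * u h) + (\<Sum>h<d. A j (Inr h) * y h)"
      unfolding U_def by (subst sum.union_disjoint) (auto simp: sum.reindex)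
    also have "\<dots> = time_gap u y j"
      using j by (simp add: A_def time_gap_def left_diff_distrib sum_subtractf
          if_distrib[of "\<lambda>z. z * _"] cong: if_cong)
    finally have "time_gap u y j = (\<Sum>i\<in>U. A j i * case_sum u y i)" ..
    also have "\<dots> = (\<Sum>i\<in>U - D. A j i * case_sum u y i) + (\<Sum>i\<in>D. A j i * case_sum u y i)"
      by (rule sum.subset_diff[OF DU fin])
    also have "(\<Sum>i\<in>D. A j i * case_sum u y i) = B j"
      unfolding B_def by (rule sum.cong) (use fixed in \<open>auto simp: D_def base_def\<close>)
    finally show ?thesis by simp
  qed
  define pat where "pat p = {j \<in> J. 0 < B j + (\<Sum>i\<in>U - D. A j i * p i)}" for p
  have "\<forall>w\<in>W. \<exists>u y. (\<exists>ts. crossing_schedule d u y ts w) \<and> length w = n \<and>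
     y a = 0 \<and> y b = 0 \<and> u e = 1 \<and> (\<forall>k<d. 1 \<le> u k \<and> nat \<lfloor>real n / u k\<rfloor> = c k)"
    unfolding W_def special_words_def by blast
  then obtain u y where uy: "\<And>w. w \<in> W \<Longrightarrow> (\<exists>ts. crossing_schedule d (u w) (y w) ts w) \<and> length w = n \<and>
     y w a = 0 \<and> y w b = 0 \<and> u w e = 1 \<and> (\<forall>k<d. 1 \<le> u w k \<and> nat \<lfloor>real n / u w k\<rfloor> = c k)"
    by metis
  have pat_eq: "pat (case_sum (u w) (y w)) = {j \<in> J. 0 < time_gap (u w) (y w) j}" if "w \<in> W" for w
    using gap[of "y w" "u w"] uy[OF that] by (auto simp: pat_def)
  \<comment> \<open>One schedule has been chosen for each word; its sign pattern recovers the
    word.\<close>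
  have "inj_on (\<lambda>w. pat (case_sum (u w) (y w))) W"
  proof (rule inj_onI)
    fix w w' assume ww: "w \<in> W" "w' \<in> W"
      and eq: "pat (case_sum (u w) (y w)) = pat (case_sum (u w') (y w'))"
    obtain ts ts' where s: "crossing_schedule d (u w) (y w) ts w" "crossing_schedule d (u w') (y w') ts' w'"
      using uy ww by blast
    show "w = w'"
    proof (rule eq_if_same_pattern[OF s(1) _ s(2) _ e])
      show "0 < time_gap (u w') (y w') j"
        if "j \<in> relevant_pairs d n c" "0 < time_gap (u w) (y w) j" for j
        using eq that unfolding pat_eq[OF ww(1)] pat_eq[OF ww(2)] J_def by blast
    qed (use uy[OF ww(1)] uy[OF ww(2)] in auto)
  qed
  then have "card W \<le> card (range pat)"
    by (rule card_inj_on_le)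
       (auto intro: finite_subset[of _ "Pow J"] simp: pat_def J_def finite_relevant_pairs)
  also have "\<dots> \<le> (card J + 1) ^ card (U - D)"
    unfolding pat_def by (rule card_sign_patterns_le) (simp_all add: J_def finite_relevant_pairs fin)
  also have "\<dots> \<le> (25 * d * d * (n + 1) + 1) ^ (2 * d - 3)"
    unfolding card_UD J_def by (intro power_mono add_right_mono card_relevant_pairs_le) simp
  finally show ?thesis by (simp add: W_def)
qed

section \<open>Growth of the complexity through left special words\<close>

lemma finite_billiard_lang: "finite (billiard_lang n d)"
proof -
  have "set w \<subseteq> {..<d}" if "billiard_code d x v w" for x v w
    using that unfolding billiard_code_def by (metis in_set_conv_nth lessThan_iff subsetI)
  then have "billiard_lang n d \<subseteq> {w. set w \<subseteq> {..<d} \<and> length w = n}"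
    unfolding billiard_lang_def by blast
  then show ?thesis by (rule finite_subset) (simp add: finite_lists_length_eq)
qed

lemma finite_special_words: "finite (special_words d n a b e c)"
proof -
  have "set w \<subseteq> {..<d}" if "crossing_schedule d u y ts w" for u y ts w
    using crossing_scheduleD(4)[OF that] by (metis in_set_conv_nth lessThan_iff subsetI)
  then have "special_words d n a b e c \<subseteq> {w. set w \<subseteq> {..<d} \<and> length w = n}"
    unfolding special_words_def by blast
  then show ?thesis by (rule finite_subset) (simp add: finite_lists_length_eq)
qed

text \<open>The base point moves to the first hit, which then occurs at time 0 and is no longer
  counted.\<close>

lemma billiard_lang_tl:
  assumes "a # w \<in> billiard_lang (n + 1) d" "n \<ge> 1"
  shows "w \<in> billiard_lang n d"
proof -
  obtain x v where xv: "billiard_code d x v (a # w)" and n: "length w = n"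
    using assms by (auto simp: billiard_lang_def)
  obtain ts where hit: "\<forall>k < Suc n. (a # w) ! k < d \<and> 0 < ts k \<and>
        x ((a # w) ! k) + ts k * v ((a # w) ! k) \<in> \<int>"
      and step: "\<forall>k < n. ts k < ts (Suc k)"
      and only: "\<forall>t i. 0 < t \<longrightarrow> t \<le> ts n \<longrightarrow> i < d \<longrightarrow> x i + t * v i \<in> \<int> \<longrightarrow>
        (\<exists>k < Suc n. t = ts k \<and> i = (a # w) ! k)"
    using xv n unfolding billiard_code_def by auto
  have less: "ts 0 < ts (Suc k)" if "k < n" for k
    using that
  proof (induction k)
    case (Suc k)
    then show ?case using step[rule_format, of "Suc k"] by auto
  qed (use step in auto)
  have "billiard_code d (\<lambda>i. x i + ts 0 * v i) v w"
    unfolding billiard_code_def n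
  proof (intro exI[of _ "\<lambda>k. ts (Suc k) - ts 0"] conjI allI impI)
    fix k assume "k < n"
    then show "w ! k < d" "0 < ts (Suc k) - ts 0"
      "x (w ! k) + ts 0 * v (w ! k) + (ts (Suc k) - ts 0) * v (w ! k) \<in> \<int>"
      using hit[rule_format, of "Suc k"] less[of k] by (auto simp: algebra_simps)
  next
    fix k assume "Suc k < n"
    then show "ts (Suc k) - ts 0 < ts (Suc (Suc k)) - ts 0" using step by auto
  next
    fix t i assume t: "0 < t" "t \<le> ts (Suc (n - 1)) - ts 0" "i < d" "x i + ts 0 * v i + t * v i \<in> \<int>"
    have "0 < ts 0" using hit by auto
    then have "\<exists>k < Suc n. ts 0 + t = ts k \<and> i = (a # w) ! k"
      using only[rule_format, of "ts 0 + t" i] t assms(2) by (simp add: algebra_simps)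
    then obtain k where "k < Suc n" "ts 0 + t = ts k" "i = (a # w) ! k" by blast
    moreover from this obtain k' where "k = Suc k'" using t(1) by (cases k) auto
    ultimately show "\<exists>k<n. t = ts (Suc k) - ts 0 \<and> i = w ! k" by (intro exI[of _ k']) auto
  qed
  then show ?thesis using n by (auto simp: billiard_lang_def)
qed

definition left_special :: "nat \<Rightarrow> nat \<Rightarrow> nat list set" where
  "left_special n d = {w \<in> billiard_lang n d. \<exists>a b. a \<noteq> b \<and>
     a # w \<in> billiard_lang (n + 1) d \<and> b # w \<in> billiard_lang (n + 1) d}"

text \<open>Deleting the first letter maps words of length \<open>n + 1\<close> to words of length
  \<open>n\<close>. A fibre has at most one element, unless the word is left special, and then at
  most \<open>d\<close>.\<close>

lemma billiard_complexity_Suc_le: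
  assumes "n \<ge> 1"
  shows "billiard_complexity (n + 1) d \<le> billiard_complexity n d + d * card (left_special n d)"
proof -
  define E where "E w = {a. a # w \<in> billiard_lang (n + 1) d}" for w
  have E: "E w \<subseteq> {..<d}" for w
    using billiard_code_Cons_schedule by (auto simp: E_def billiard_lang_def)
  then have finE: "finite (E w)" for w by (rule finite_subset) simp
  have "billiard_lang (n + 1) d \<subseteq> (\<lambda>(w, a). a # w) ` (SIGMA w : billiard_lang n d. E w)"
  proof
    fix z assume z: "z \<in> billiard_lang (n + 1) d"
    then obtain a w where aw: "z = a # w" by (cases z) (auto simp: billiard_lang_def)
    then have "(w, a) \<in> (SIGMA w : billiard_lang n d. E w)"
      using z billiard_lang_tl[OF _ assms] by (auto simp: E_def)
    then show "z \<in> (\<lambda>(w, a). a # w) ` (SIGMA w : billiard_lang n d. E w)"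
      using aw by force
  qed
  then have "card (billiard_lang (n + 1) d) \<le> card (SIGMA w : billiard_lang n d. E w)"
    by (intro surj_card_le finite_SigmaI finE finite_billiard_lang)
  also have "\<dots> = (\<Sum>w\<in>billiard_lang n d. card (E w))"
    by (simp add: finite_billiard_lang finE)
  also have "\<dots> \<le> (\<Sum>w\<in>billiard_lang n d. 1 + (if w \<in> left_special n d then d else 0))"
  proof (rule sum_mono)
    fix w assume w: "w \<in> billiard_lang n d"
    show "card (E w) \<le> 1 + (if w \<in> left_special n d then d else 0)"
    proof (cases "w \<in> left_special n d")
      case True
      then show ?thesis using card_mono[OF _ E[of w]] by simp
    next
      case False
      then have "\<And>a b. a \<in> E w \<Longrightarrow> b \<in> E w \<Longrightarrow> a = b"
        using w by (auto simp: E_def left_special_def)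
      then show ?thesis using False by (simp add: card_le_Suc0_iff_eq finE)
    qed
  qed
  also have "\<dots> = card (billiard_lang n d) + d * card (left_special n d)"
  proof -
    have "billiard_lang n d \<inter> {w. w \<in> left_special n d} = left_special n d"
      by (auto simp: left_special_def)
    then show ?thesis
      unfolding sum.distrib by (simp add: sum.If_cases finite_billiard_lang)
  qed
  finally show ?thesis by (simp add: billiard_complexity_def)
qed

lemma card_UN_le_mult:
  assumes "finite I" "\<And>i. i \<in> I \<Longrightarrow> card (A i) \<le> K"
  shows "card (\<Union>i\<in>I. A i) \<le> card I * K"
  using card_UN_le[OF assms(1), of A] sum_bounded_above[of I "\<lambda>i. card (A i)" K] assms(2)
  by (simp add: order_trans)

text \<open>The factors count the two axes of the edge, the fastest axis, the boxes of directions,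
  and the sign patterns within one box.\<close>

lemma card_left_special_le:
  "card (left_special n d) \<le> d * (d * (d * ((n + 1) ^ (d - 1) * (25 * d * d * (n + 1) + 1) ^ (2 * d - 3))))"
proof -
  define X where "X a b e = (\<Union>c \<in> {..<d} - {e} \<rightarrow>\<^sub>E {..n}. special_words d n a b e (c(e := n)))" for a b e
  define Y where "Y = (\<Union>a\<in>{..<d}. \<Union>b\<in>{..<d} - {a}. \<Union>e\<in>{..<d}. X a b e)"
  have "left_special n d \<subseteq> Y"
  proof
    fix w assume "w \<in> left_special n d"
    then obtain a b x v x' v' where "a \<noteq> b" "billiard_code d x v (a # w)" "billiard_code d x' v' (b # w)"
      "length w = n"
      by (auto simp: left_special_def billiard_lang_def)
    then show "w \<in> Y"
      using left_special_mem_special_words[of d x v a w x' v' b n] by (fastforce simp: Y_def X_def)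
  qed
  moreover have "finite Y"
    by (auto simp: Y_def X_def intro!: finite_UN_I finite_PiE finite_special_words)
  ultimately have "card (left_special n d) \<le> card Y" by (intro card_mono)
  also have "\<dots> \<le> d * (d * (d * ((n + 1) ^ (d - 1) * (25 * d * d * (n + 1) + 1) ^ (2 * d - 3))))"
    (is "_ \<le> d * (d * (d * ?K))")
  proof -
    have X: "card (X a b e) \<le> ?K" if "a < d" "b < d" "a \<noteq> b" "e < d" for a b e
    proof -
      have "card (X a b e) \<le> card ({..<d} - {e} \<rightarrow>\<^sub>E {..n}) * (25 * d * d * (n + 1) + 1) ^ (2 * d - 3)"
        unfolding X_def
        by (intro card_UN_le_mult finite_PiE card_special_words_le that) auto
      then show ?thesis using that by (simp add: card_PiE)
    qed
    have "card (\<Union>b\<in>{..<d} - {a}. \<Union>e\<in>{..<d}. X a b e) \<le> d * (d * ?K)" if a: "a < d" for a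
    proof -
      have "card (\<Union>b\<in>{..<d} - {a}. \<Union>e\<in>{..<d}. X a b e) \<le> card ({..<d} - {a}) * (card {..<d} * ?K)"
        by (intro card_UN_le_mult X) (use a in auto)
      also have "\<dots> \<le> d * (d * ?K)" using a by (intro mult_mono) (auto simp: card_Diff_singleton)
      finally show ?thesis .
    qed
    then have "card Y \<le> card {..<d} * (d * (d * ?K))"
      unfolding Y_def by (intro card_UN_le_mult) auto
    then show ?thesis by simp
  qed
  finally show ?thesis .
qed

theorem mainTheorem2:
  fixes d :: nat
  assumes "d \<ge> 2"
  shows "\<exists>C > (0::real). \<forall>n \<ge> 1.
           real (billiard_complexity (n + 1) d) - real (billiard_complexity n d)
             \<le> C * real n ^ (3 * d - 4)"
proof -
  \<comment> \<open>One factor \<open>d\<close> bounds the left extensions, three more the choices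
    of axes; the powers come from \<open>n + 1 \<le> 2 * n\<close> and from \<open>base\<close>
    below.\<close>
  define C where "C = d * (d * (d * (d * (2 ^ (d - 1) * (51 * d * d) ^ (2 * d - 3)))))"
  have "real (billiard_complexity (n + 1) d) - real (billiard_complexity n d) \<le> real C * real n ^ (3 * d - 4)"
    if n: "n \<ge> 1" for n
  proof -
    have "1 * 1 \<le> d * d" using assms by (intro mult_le_mono) auto
    then have "1 * 1 \<le> d * d * n" using n by (intro mult_le_mono) auto
    then have base: "25 * d * d * (n + 1) + 1 \<le> 51 * d * d * n"
    proof -
      have "25 * (d * d) * (n + 1) \<le> 25 * (d * d) * (2 * n)" using n by (intro mult_le_mono) auto
      moreover have "25 * d * d * (n + 1) = 25 * (d * d) * (n + 1)"
        "25 * (d * d) * (2 * n) = 50 * (d * d * n)" "51 * d * d * n = 51 * (d * d * n)"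
        by simp_all
      ultimately show ?thesis using \<open>1 * 1 \<le> d * d * n\<close> by linarith
    qed
    have "(n + 1) ^ (d - 1) * (25 * d * d * (n + 1) + 1) ^ (2 * d - 3)
        \<le> (2 * n) ^ (d - 1) * (51 * d * d * n) ^ (2 * d - 3)"
      using n by (intro mult_le_mono power_mono base) auto
    also have "\<dots> = 2 ^ (d - 1) * (51 * d * d) ^ (2 * d - 3) * n ^ ((d - 1) + (2 * d - 3))"
      by (simp only: power_mult_distrib power_add mult_ac)
    \<comment> \<open>Boxes contribute the exponent d - 1 and sign patterns 2d - 3; truncated
      subtraction is harmless because d is at least 2.\<close>
    also have "(d - 1) + (2 * d - 3) = 3 * d - 4" using assms by simp
    finally have "d * (d * (d * (d * ((n + 1) ^ (d - 1) * (25 * d * d * (n + 1) + 1) ^ (2 * d - 3)))))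
        \<le> d * (d * (d * (d * (2 ^ (d - 1) * (51 * d * d) ^ (2 * d - 3) * n ^ (3 * d - 4)))))"
      by (intro mult_le_mono2)
    also have "\<dots> = C * n ^ (3 * d - 4)" by (simp only: C_def mult_ac)
    finally have "d * card (left_special n d) \<le> C * n ^ (3 * d - 4)"
      using mult_le_mono2[OF card_left_special_le[of n d], of d] by linarith
    then have "billiard_complexity (n + 1) d \<le> billiard_complexity n d + C * n ^ (3 * d - 4)"
      using billiard_complexity_Suc_le[OF n, of d] by linarith
    then have "real (billiard_complexity (n + 1) d) \<le> real (billiard_complexity n d + C * n ^ (3 * d - 4))"
      by (simp only: of_nat_le_iff)
    then show ?thesis by simp
  qed
  moreover have "0 < real C" using assms by (simp add: C_def)
  ultimately show ?thesis by blast
qed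

end
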